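(* Let $G=(V,E)$ be a finite simple connected unweighted graph with $|V|\ge 2$. There exists a polynomial $p_G(\mathbf n)$ in the variables $\mathbf n=\{n_v : v\in V\}$, with integer coefficients, such that $$\det D_{G[\mathbf n]} = (-2)^{\sum_{v\in V}(n_v-1)}\, p_G(\mathbf n)\qquad\text{for all } \mathbf n\in \mathbb{Z}_{>0}^V .$$ Moreover, $p_G$ is multi-affine in $\mathbf n$ (that is, $\deg_{n_v}(p_G)\le 1$ for every $v\in V$), its constant term is $(-2)^{|V|}$, and its linear term (homogeneous part of degree $1$) is $-(-2)^{|V|}\sum_{v\in V} n_v$.
   Context: For a finite simple connected graph $H$, its distance matrix $D_H$ is the matrix indexed by $V(H)\times V(H)$ whose $(v,w)$ entry is the length of a shortest path from $v$ to $w$ if $v\ne w$, and $0$ if $v=w$. Given a graph $G=(V,E)$ and positive integers $\mathbf n=\{n_v: v\in V\}$, the blowup graph $G[\mathbf n]$ is the finite simple graph having $n_v$ copies of each vertex $v\in V$, in which a copy of $v$ is adjacent to a copy of $w$ if and only if $v\neq w$ and $(v,w)\in E$. If $|V|\ge 2$ and $G$ is connected, then $G[\mathbf n]$ is connected, so $D_{G[\mathbf n]}$ is defined. *)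

theory Defs
  imports
    "Graph_Theory.Graph_Theory"
    "Jordan_Normal_Form.Determinant"
    "HOL-Library.Poly_Mapping"
begin

section \<open>Distance matrices\<close>

text \<open>Finite simple graphs are the symmetric loop-free digraphs \<open>pair_graph\<close> of the
  \<open>Graph_Theory\<close> entry: an edge between \<open>v\<close> and \<open>w\<close> is the pair of arcs \<open>(v, w)\<close>, \<open>(w, v)\<close>.
  The value of \<open>path_dist\<close> is unspecified if no path exists; by \<open>connected_blowup\<close> below
  this does not occur for the blowups considered here.\<close>

definition path_dist :: "'v pair_pre_digraph \<Rightarrow> 'v \<Rightarrow> 'v \<Rightarrow> nat" where
  "path_dist H v w = (LEAST k. \<exists>p. pre_digraph.apath (with_proj H) v p w \<and> length p = k)"

definition is_enumeration :: "'a list \<Rightarrow> 'a set \<Rightarrow> bool" where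
  "is_enumeration xs A \<longleftrightarrow> distinct xs \<and> set xs = A"

text \<open>Matrices are indexed by initial segments of the natural numbers, so the
  distance matrix is taken with respect to an enumeration \<open>xs\<close> of the vertices; the
  theorem quantifies over all enumerations.\<close>

definition distance_matrix :: "'v pair_pre_digraph \<Rightarrow> 'v list \<Rightarrow> int mat" where
  "distance_matrix H xs =
     mat (length xs) (length xs)
       (\<lambda>(i, j). if xs ! i = xs ! j then 0 else int (path_dist H (xs ! i) (xs ! j)))"


section \<open>Blowups\<close>

text \<open>The copies of \<open>v\<close> are the pairs \<open>(v, i)\<close> with \<open>i < n v\<close>.\<close>

definition blowup :: "'v pair_pre_digraph \<Rightarrow> ('v \<Rightarrow> nat) \<Rightarrow> ('v \<times> nat) pair_pre_digraph" where
  "blowup G n =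
     \<lparr> pverts = {(v, i). v \<in> pverts G \<and> i < n v},
       parcs = {((v, i), (w, j)). v \<in> pverts G \<and> i < n v \<and> w \<in> pverts G \<and> j < n w \<and>
                  v \<noteq> w \<and> (v, w) \<in> parcs G} \<rparr>"

lemma pair_graph_blowup:
  assumes "pair_graph G"
  shows "pair_graph (blowup G n)"
proof -
  interpret G: pair_graph G by fact
  have fin: "finite (pverts (blowup G n))"
  proof -
    have "pverts (blowup G n) = (SIGMA v:pverts G. {..<n v})"
      by (auto simp: blowup_def)
    then show ?thesis by (simp add: G.pair_finite_verts)
  qed
  have sub: "parcs (blowup G n) \<subseteq> pverts (blowup G n) \<times> pverts (blowup G n)"
    by (auto simp: blowup_def)
  have finA: "finite (parcs (blowup G n))"
    by (rule finite_subset[OF sub]) (simp add: fin)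
  have "sym (parcs G)"
    using G.pair_sym_arcs by (simp add: symmetric_def)
  then have "sym (parcs (blowup G n))"
    by (auto simp: blowup_def sym_def)
  then show ?thesis
    by unfold_locales
      (use fin finA in \<open>auto simp: symmetric_def\<close>, auto simp: blowup_def)
qed

lemma connected_pair_graph_iff:
  assumes "pair_graph H"
  shows "Digraph_Component.connected (with_proj H) \<longleftrightarrow> strongly_connected (with_proj H)"
proof -
  interpret H: pair_graph H by fact
  show ?thesis
    using H.reachable_mk_symmetric_eq[OF H.pair_sym_arcs]
    by (simp add: connected_def strongly_connected_def)
qed

lemma connected_blowup:
  assumes G: "pair_graph G" "Digraph_Component.connected (with_proj G)" "card (pverts G) \<ge> 2"
    and n: "\<forall>v\<in>pverts G. n v > 0"
  shows "Digraph_Component.connected (with_proj (blowup G n))"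
proof -
  interpret G: pair_graph G by fact
  interpret B: pair_graph "blowup G n" by (rule pair_graph_blowup[OF G(1)])
  have sc: "strongly_connected (with_proj G)"
    using G(2) connected_pair_graph_iff[OF G(1)] by simp
  have bedge: "((v,i),(w,j)) \<in> parcs (blowup G n)"
    if "(v,w) \<in> parcs G" "i < n v" "j < n w" for v w i j
    using that G.arc_fst_in_verts[OF that(1)] G.arc_snd_in_verts[OF that(1)]
      G.pair_no_loops[OF that(1)]
    by (auto simp: blowup_def)
  have trans: "(v,i) \<rightarrow>\<^sup>*\<^bsub>with_proj (blowup G n)\<^esub> (u,k)"
    if "(v,i) \<rightarrow>\<^sup>*\<^bsub>with_proj (blowup G n)\<^esub> (w,j)" "(w,u) \<in> parcs G" "j < n w" "k < n u" for v w u i j k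
    using that bedge B.reachable_adj_trans by (metis with_proj_simps(3))
  have step: "w = v \<or> (\<forall>i<n v. \<forall>j<n w. (v,i) \<rightarrow>\<^sup>*\<^bsub>with_proj (blowup G n)\<^esub> (w,j))"
    if "v \<rightarrow>\<^sup>*\<^bsub>with_proj G\<^esub> w" for v w
    using that
  proof (induction rule: G.reachable_induct)
    case base
    then show ?case by simp
  next
    case (step w u)
    have wu: "(w,u) \<in> parcs G" using step by simp
    have nw: "0 < n w" using n wu G.arc_fst_in_verts by fastforce
    have vV: "v \<in> pverts G" using step(1) G.reachable_in_verts by blast
    show ?case
    proof (intro disjI2 allI impI)
      fix i j assume ij: "i < n v" "j < n u"
      show "(v,i) \<rightarrow>\<^sup>*\<^bsub>with_proj (blowup G n)\<^esub> (u,j)"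
      proof (cases "w = v")
        case True
        have "(v,i) \<rightarrow>\<^sup>*\<^bsub>with_proj (blowup G n)\<^esub> (v,i)"
          using vV ij by (intro B.reachable_refl) (auto simp: blowup_def)
        then show ?thesis using trans wu ij True by blast
      next
        case False
        then show ?thesis using step.IH trans wu ij nw by blast
      qed
    qed
  qed
  have nb: "\<exists>w. (v,w) \<in> parcs G" if v: "v \<in> pverts G" for v
  proof -
    obtain w where w: "w \<in> pverts G" "w \<noteq> v"
    proof (cases "\<exists>w\<in>pverts G. w \<noteq> v")
      case False
      then have "pverts G \<subseteq> {v}" by auto
      then have "card (pverts G) \<le> 1"
        by (metis card_mono card.empty card_insert_disjoint empty_iff finite.intros One_nat_def)
      with G(3) show ?thesis by simp
    qed (use that in blast)
    then have "v \<rightarrow>\<^sup>*\<^bsub>with_proj G\<^esub> w"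
      using sc v by (auto simp: strongly_connected_def)
    then show ?thesis
      using w by (cases rule: G.converse_reachable_cases) auto
  qed
  have "a \<rightarrow>\<^sup>*\<^bsub>with_proj (blowup G n)\<^esub> b"
    if "a \<in> pverts (blowup G n)" "b \<in> pverts (blowup G n)" for a b
  proof -
    obtain v i w j where ab: "a = (v,i)" "b = (w,j)" "v \<in> pverts G" "i < n v" "w \<in> pverts G" "j < n w"
      using \<open>a \<in> _\<close> \<open>b \<in> _\<close> by (auto simp: blowup_def)
    show ?thesis
    proof (cases "v = w")
      case False
      then show ?thesis using step sc ab by (auto simp: strongly_connected_def)
    next
      case True
      obtain u where u: "(v,u) \<in> parcs G" using nb ab by blast
      then have u': "(u,v) \<in> parcs G" using G.pair_sym_arcs by (auto simp: symmetric_def sym_def)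
      have nu: "0 < n u" using n u G.arc_snd_in_verts by fastforce
      have "(v,i) \<rightarrow>\<^sup>*\<^bsub>with_proj (blowup G n)\<^esub> (v,i)"
        using ab by (intro B.reachable_refl) (auto simp: blowup_def)
      then have "(v,i) \<rightarrow>\<^sup>*\<^bsub>with_proj (blowup G n)\<^esub> (u,0)" using trans u nu ab by blast
      then show ?thesis using trans u' nu ab True by blast
    qed
  qed
  moreover have "pverts (blowup G n) \<noteq> {}"
  proof -
    obtain v where "v \<in> pverts G" using G(3) by fastforce
    then show ?thesis using n by (auto simp: blowup_def)
  qed
  ultimately show ?thesis
    by (simp add: connected_pair_graph_iff[OF B.pair_graph] strongly_connected_def)
qed


section \<open>Multivariate polynomials\<close>

text \<open>Monomials are the finitely supported exponent functions \<open>'v \<Rightarrow>\<^sub>0 nat\<close>; the ring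
  structure on \<open>('v \<Rightarrow>\<^sub>0 nat) \<Rightarrow>\<^sub>0 int\<close> is the convolution product of \<open>Poly_Mapping\<close>.\<close>

type_synonym 'v mpoly_int = "('v \<Rightarrow>\<^sub>0 nat) \<Rightarrow>\<^sub>0 int"

definition mvar :: "'v \<Rightarrow> 'v mpoly_int" where
  "mvar v = Poly_Mapping.single (Poly_Mapping.single v 1) 1"

definition mvars :: "'v mpoly_int \<Rightarrow> 'v set" where
  "mvars p = (\<Union>m\<in>Poly_Mapping.keys p. Poly_Mapping.keys m)"

definition meval :: "'v mpoly_int \<Rightarrow> ('v \<Rightarrow> int) \<Rightarrow> int" where
  "meval p x = (\<Sum>m\<in>Poly_Mapping.keys p.
     Poly_Mapping.lookup p m * (\<Prod>v\<in>Poly_Mapping.keys m. x v ^ Poly_Mapping.lookup m v))"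

definition mdegree_in :: "'v \<Rightarrow> 'v mpoly_int \<Rightarrow> nat" where
  "mdegree_in v p = Max (insert 0 ((\<lambda>m. Poly_Mapping.lookup m v) ` Poly_Mapping.keys p))"

definition constant_term :: "'v mpoly_int \<Rightarrow> int" where
  "constant_term p = Poly_Mapping.lookup p 0"

definition monom_degree :: "('v \<Rightarrow>\<^sub>0 nat) \<Rightarrow> nat" where
  "monom_degree m = (\<Sum>v\<in>Poly_Mapping.keys m. Poly_Mapping.lookup m v)"

definition homogeneous_part :: "nat \<Rightarrow> 'v mpoly_int \<Rightarrow> 'v mpoly_int" where
  "homogeneous_part d p = (\<Sum>m\<in>{m \<in> Poly_Mapping.keys p. monom_degree m = d}.
     Poly_Mapping.single m (Poly_Mapping.lookup p m))"

end

theory Submission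
  imports Defs
begin

text \<open>
  Any two distinct copies of one vertex \<open>v\<close> of \<open>G\<close> have distance \<open>2\<close> in the blowup: they are not
  adjacent, and they share the copies of a neighbour of \<open>v\<close>, which exists because \<open>G\<close> is
  connected and has a second vertex. Copies of distinct vertices are as
  far apart as the vertices themselves. Hence \<open>D = W - 2 I\<close>, where the entry of \<open>W\<close> at a copy of
  \<open>v\<close> and a copy of \<open>w\<close> is \<open>M v w\<close>, for the matrix \<open>M\<close> that agrees with the distance matrix of \<open>G\<close>
  off the diagonal and has \<open>2\<close> on the diagonal.

  A determinant of the form \<open>det (W + c I)\<close>, over an index set of size \<open>N\<close>, is the sum over all sets
  \<open>S\<close> of indices of \<open>c\<close> to the power \<open>N - card S\<close> times the principal minor of \<open>W\<close> on \<open>S\<close>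
  (\<open>det_on_add_diagonal\<close>). If \<open>S\<close> contains two copies of the same vertex, then this minor has two
  equal rows and vanishes. Otherwise \<open>S\<close> picks one copy of each vertex of some set \<open>T\<close> of vertices
  of \<open>G\<close>, the minor equals the principal minor of \<open>M\<close> on \<open>T\<close>, and there are as many such \<open>S\<close> as
  the product of the \<open>n v\<close> for \<open>v\<close> in \<open>T\<close> (\<open>card_transversals\<close>). Altogether
  (\<open>det_on_replicated\<close>), with \<open>c = -2\<close>, the determinant of \<open>D\<close> is
  \<open>\<Sum>T\<in>Pow V. (-2) ^ (N - card T) * det_on T M * (\<Prod>v\<in>T. n v)\<close>.
  As \<open>N\<close> is the sum of the \<open>n v\<close>, the power of \<open>-2\<close> in the theorem can be taken out of every summand,
  and what remains is visibly a multi-affine polynomial, whose coefficient at the product of the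
  variables in \<open>T\<close> is \<open>blowup_coeff G T\<close>. For \<open>T = {}\<close> the minor is \<open>1\<close>, for \<open>T = {v}\<close> it is \<open>2\<close>;
  this gives the constant and the linear term.
\<close>

section \<open>Determinants indexed by a finite set\<close>

text \<open>The Leibniz formula. Principal minors on arbitrary vertex sets, and a comparison of minors
  along a map between vertex sets, need no numbering of the indices in this form.\<close>

definition det_on :: "'a set \<Rightarrow> ('a \<Rightarrow> 'a \<Rightarrow> 'c::comm_ring_1) \<Rightarrow> 'c" where
  "det_on A f = (\<Sum>p | p permutes A. of_int (sign p) * (\<Prod>a\<in>A. f a (p a)))"

lemma det_on_cong:
  assumes "\<And>a b. a \<in> A \<Longrightarrow> b \<in> A \<Longrightarrow> f a b = g a b"
  shows "det_on A f = det_on A g"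
  unfolding det_on_def
  by (intro sum.cong refl arg_cong2[where f = "(*)"] prod.cong)
     (auto simp: permutes_in_image assms)

lemma det_on_empty [simp]: "det_on {} f = 1"
  by (simp add: det_on_def permutes_empty)

lemma det_on_singleton [simp]: "det_on {a} f = f a a"
  by (simp add: det_on_def permutes_sing)

lemma det_on_image:
  assumes "finite A" "inj_on h A"
  shows "det_on (h ` A) f = det_on A (\<lambda>a b. f (h a) (h b))"
proof -
  have bij: "bij_betw h A (h ` A)"
    using assms(2) by (simp add: bij_betw_def)
  have bij': "bij_betw (inv_into A h) (h ` A) A"
    by (rule bij_betw_inv_into[OF bij])
  have "(\<Sum>p | p permutes A. of_int (sign p) * (\<Prod>a\<in>A. f (h a) (h (p a)))) =
        (\<Sum>q | q permutes h ` A. of_int (sign q) * (\<Prod>b\<in>h ` A. f b (q b)))"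
  proof (rule sum.reindex_bij_witness[where j = "map_permutation A h"
        and i = "map_permutation (h ` A) (inv_into A h)"])
    fix p assume p: "p \<in> {p. p permutes A}"
    show "map_permutation (h ` A) (inv_into A h) (map_permutation A h p) = p"
      using p assms(2) by (intro map_permutation_compose_inv[OF bij]) auto
    show "map_permutation A h p \<in> {q. q permutes h ` A}"
      using p map_permutation_permutes[OF bij] by blast
    have "(\<Prod>b\<in>h ` A. f b (map_permutation A h p b)) = (\<Prod>a\<in>A. f (h a) (h (p a)))"
      by (simp add: prod.reindex[OF assms(2)] map_permutation_apply[OF assms(2)])
    then show "of_int (sign (map_permutation A h p)) * (\<Prod>b\<in>h ` A. f b (map_permutation A h p b))
        = of_int (sign p) * (\<Prod>a\<in>A. f (h a) (h (p a)))"
      using p assms by (simp add: sign_map_permutation)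
  next
    fix q assume q: "q \<in> {q. q permutes h ` A}"
    show "map_permutation A h (map_permutation (h ` A) (inv_into A h) q) = q"
      using q by (intro map_permutation_compose_inv[OF bij']) (auto simp: f_inv_into_f)
    show "map_permutation (h ` A) (inv_into A h) q \<in> {p. p permutes A}"
      using q map_permutation_permutes[OF bij'] by blast
  qed
  then show ?thesis by (simp add: det_on_def)
qed

lemma det_mat_eq_det_on:
  assumes "distinct xs"
  shows "Determinant.det (mat (length xs) (length xs) (\<lambda>(i, j). f (xs ! i) (xs ! j)))
           = det_on (set xs) f"
proof -
  have set: "set xs = (!) xs ` {0..<length xs}"
    by (auto simp: set_conv_nth)
  have inj: "inj_on ((!) xs) {0..<length xs}"
    using assms by (intro inj_on_nth) auto
  show ?thesis
    unfolding set det_on_image[OF finite_atLeastLessThan inj] unfolding det_on_def det_def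
    by (auto intro!: sum.cong prod.cong simp: permutes_in_image)
qed

lemma det_on_identical_rows:
  assumes "finite A" "a \<in> A" "b \<in> A" "a \<noteq> b" "\<And>c. c \<in> A \<Longrightarrow> f a c = f b c"
  shows "det_on A f = 0"
proof -
  obtain xs where xs: "distinct xs" "set xs = A"
    using finite_distinct_list[OF assms(1)] by blast
  obtain i j where ij: "i < length xs" "xs ! i = a" "j < length xs" "xs ! j = b"
    using assms(2,3) xs(2) by (metis in_set_conv_nth)
  let ?A = "mat (length xs) (length xs) (\<lambda>(i, j). f (xs ! i) (xs ! j))"
  have "row ?A i = row ?A j"
    using ij assms(5) xs(2) by (intro eq_vecI) auto
  then have "Determinant.det ?A = 0"
    using ij assms(4) by (intro det_identical_rows[of _ "length xs" i j]) auto
  then show ?thesis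
    using det_mat_eq_det_on[OF xs(1), of f] xs(2) by simp
qed

text \<open>The expansion of a diagonal perturbation into principal minors. Multiplying out the product
  for a permutation \<open>p\<close>, the factors taken from the diagonal matrix on \<open>A - S\<close> survive only if \<open>p\<close>
  fixes \<open>A - S\<close> pointwise, that is, if \<open>p\<close> is a permutation of \<open>S\<close>; the signs agree since both
  sides use the same function \<open>p\<close>.\<close>

lemma det_on_add_diagonal:
  assumes "finite A"
  shows "det_on A (\<lambda>a b. f a b + (if a = b then d a else 0)) =
           (\<Sum>S\<in>Pow A. (\<Prod>a\<in>A - S. d a) * det_on S f)"
proof -
  let ?P = "{p. p permutes A}"
  let ?t = "\<lambda>p S. of_int (sign p) * ((\<Prod>a\<in>S. f a (p a)) *
                 (\<Prod>a\<in>A - S. if a = p a then d a else 0))"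
  have "det_on A (\<lambda>a b. f a b + (if a = b then d a else 0)) = (\<Sum>p\<in>?P. \<Sum>S\<in>Pow A. ?t p S)"
    unfolding det_on_def prod_add[OF assms] by (simp add: sum_distrib_left)
  also have "\<dots> = (\<Sum>S\<in>Pow A. \<Sum>p\<in>?P. ?t p S)"
    by (rule sum.swap)
  also have "\<dots> = (\<Sum>S\<in>Pow A. (\<Prod>a\<in>A - S. d a) * det_on S f)"
  proof (rule sum.cong)
    fix S assume "S \<in> Pow A"
    then have S: "S \<subseteq> A" by simp
    have "(\<Sum>p\<in>?P. ?t p S) = (\<Sum>p | p permutes S. ?t p S)"
    proof (rule sum.mono_neutral_right)
      show "finite ?P" using assms by (rule finite_permutations)
      show "{p. p permutes S} \<subseteq> ?P" using S permutes_subset by blast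
      show "\<forall>p\<in>?P - {p. p permutes S}. ?t p S = 0"
      proof
        fix p assume p: "p \<in> ?P - {p. p permutes S}"
        then obtain a where "a \<in> A - S" "p a \<noteq> a"
          using permutes_superset[of p A S] by blast
        then have "(\<Prod>a\<in>A - S. if a = p a then d a else 0) = 0"
          using assms by (intro prod_zero bexI[of _ a]) auto
        then show "?t p S = 0" by simp
      qed
    qed
    also have "\<dots> = (\<Sum>p | p permutes S. of_int (sign p) *
                        ((\<Prod>a\<in>S. f a (p a)) * (\<Prod>a\<in>A - S. d a)))"
    proof (intro sum.cong refl arg_cong2[where f = "(*)"] prod.cong)
      fix p a assume "p \<in> {p. p permutes S}" "a \<in> A - S"
      then have "p a = a" by (auto simp: permutes_not_in)
      then show "(if a = p a then d a else 0) = d a" by simp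
    qed
    also have "\<dots> = (\<Prod>a\<in>A - S. d a) * det_on S f"
      by (simp add: det_on_def sum_distrib_left mult_ac)
    finally show "(\<Sum>p\<in>?P. ?t p S) = (\<Prod>a\<in>A - S. d a) * det_on S f" .
  qed simp
  finally show ?thesis .
qed


section \<open>Replicating the rows and columns of a matrix\<close>

text \<open>Sets that meet each fibre over \<open>T\<close> exactly once, and no other fibre, are the graphs of the
  choice functions on \<open>T\<close>.\<close>

lemma card_transversals:
  assumes "finite T" "T \<subseteq> V"
  shows "card {S. S \<subseteq> Sigma V B \<and> inj_on fst S \<and> fst ` S = T} = (\<Prod>v\<in>T. card (B v))"
proof -
  let ?g = "\<lambda>f. (\<lambda>v. (v, f v)) ` T"
  have "bij_betw ?g (PiE T B) {S. S \<subseteq> Sigma V B \<and> inj_on fst S \<and> fst ` S = T}"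
  proof (rule bij_betw_imageI)
    show "inj_on ?g (PiE T B)"
    proof (rule inj_onI)
      fix f f' assume f: "f \<in> PiE T B" and f': "f' \<in> PiE T B" and eq: "?g f = ?g f'"
      show "f = f'"
      proof (rule PiE_ext[OF f f'])
        fix v assume "v \<in> T"
        then have "(v, f v) \<in> ?g f'" unfolding eq[symmetric] by (rule imageI)
        then show "f v = f' v" by auto
      qed
    qed
    show "?g ` PiE T B = {S. S \<subseteq> Sigma V B \<and> inj_on fst S \<and> fst ` S = T}"
    proof (intro equalityI subsetI)
      fix S assume "S \<in> ?g ` PiE T B"
      then obtain f where f: "f \<in> PiE T B" "S = ?g f" by blast
      then show "S \<in> {S. S \<subseteq> Sigma V B \<and> inj_on fst S \<and> fst ` S = T}"
        using assms(2) by (auto simp: inj_on_def image_image)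
    next
      fix S assume "S \<in> {S. S \<subseteq> Sigma V B \<and> inj_on fst S \<and> fst ` S = T}"
      then have S: "S \<subseteq> Sigma V B" "inj_on fst S" "fst ` S = T" by auto
      define f where "f = restrict (\<lambda>v. snd (inv_into S fst v)) T"
      have f: "(v, f v) \<in> S" if "v \<in> T" for v
      proof -
        have "inv_into S fst v \<in> S" "fst (inv_into S fst v) = v"
          using that S(3) by (auto intro: inv_into_into f_inv_into_f)
        then show ?thesis using that by (simp add: f_def) (metis prod.collapse)
      qed
      have "S = ?g f"
      proof (intro equalityI subsetI)
        fix x assume x: "x \<in> S"
        then have "fst x \<in> T" using S(3) by blast
        with f have "(fst x, f (fst x)) \<in> S" by blast
        with x S(2) have "x = (fst x, f (fst x))"
          by (metis fst_conv inj_onD)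
        then show "x \<in> ?g f" using \<open>fst x \<in> T\<close> by (metis image_eqI)
      qed (use f in auto)
      moreover have "f \<in> PiE T B"
        using f S(1) by (auto simp: f_def)
      ultimately show "S \<in> ?g ` PiE T B" by blast
    qed
  qed
  then have "card {S. S \<subseteq> Sigma V B \<and> inj_on fst S \<and> fst ` S = T} = card (PiE T B)"
    by (rule bij_betw_same_card[symmetric])
  then show ?thesis by (simp add: card_PiE[OF assms(1)])
qed

text \<open>The matrix \<open>M (fst x) (fst y)\<close> has one row and column for each element of \<open>B v\<close> in place of
  the row and column \<open>v\<close>. Its rank stays bounded by the size of \<open>V\<close>, so only few principal minors
  contribute to the expansion: those on transversals, which are principal minors of \<open>M\<close>.\<close>

lemma det_on_replicated:
  fixes M :: "'v \<Rightarrow> 'v \<Rightarrow> 'c::comm_ring_1"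
  assumes V: "finite V" and B: "\<And>v. v \<in> V \<Longrightarrow> finite (B v)"
  shows "det_on (Sigma V B) (\<lambda>x y. M (fst x) (fst y) + (if x = y then c else 0)) =
    (\<Sum>T\<in>Pow V. c ^ (card (Sigma V B) - card T) * det_on T M * of_nat (\<Prod>v\<in>T. card (B v)))"
proof -
  let ?X = "Sigma V B"
  let ?I = "{S. S \<subseteq> ?X \<and> inj_on fst S}"
  let ?M = "\<lambda>x y. M (fst x) (fst y)"
  define g where "g T = c ^ (card ?X - card T) * det_on T M" for T
  have fin: "finite ?X" using V B by (rule finite_SigmaI)
  have finI: "finite ?I" by (rule finite_subset[of _ "Pow ?X"]) (use fin in auto)
  have "det_on ?X (\<lambda>x y. ?M x y + (if x = y then c else 0)) =
          (\<Sum>S\<in>Pow ?X. (\<Prod>x\<in>?X - S. c) * det_on S ?M)"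
    by (rule det_on_add_diagonal[OF fin])
  also have "\<dots> = (\<Sum>S\<in>?I. (\<Prod>x\<in>?X - S. c) * det_on S ?M)"
  proof (rule sum.mono_neutral_right)
    show "\<forall>S\<in>Pow ?X - ?I. (\<Prod>x\<in>?X - S. c) * det_on S ?M = 0"
    proof
      fix S assume S: "S \<in> Pow ?X - ?I"
      then obtain x y where "x \<in> S" "y \<in> S" "x \<noteq> y" "fst x = fst y"
        by (auto simp: inj_on_def)
      then have "det_on S ?M = 0"
        using S finite_subset[OF _ fin] by (intro det_on_identical_rows[of S x y]) auto
      then show "(\<Prod>x\<in>?X - S. c) * det_on S ?M = 0" by simp
    qed
  qed (use fin in auto)
  also have "\<dots> = (\<Sum>S\<in>?I. g (fst ` S))"
  proof (rule sum.cong)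
    fix S assume "S \<in> ?I"
    then have S: "S \<subseteq> ?X" "inj_on fst S" by auto
    then have "finite S" using fin finite_subset by blast
    then show "(\<Prod>x\<in>?X - S. c) * det_on S ?M = g (fst ` S)"
      using S by (simp add: g_def det_on_image card_image card_Diff_subset)
  qed simp
  also have "\<dots> = (\<Sum>T\<in>Pow V. \<Sum>S\<in>{S \<in> ?I. fst ` S = T}. g (fst ` S))"
    by (rule sum.group[symmetric]) (use finI V in auto)
  also have "\<dots> = (\<Sum>T\<in>Pow V. g T * of_nat (\<Prod>v\<in>T. card (B v)))"
  proof (rule sum.cong)
    fix T assume "T \<in> Pow V"
    then have T: "finite T" "T \<subseteq> V" using V finite_subset by auto
    have "(\<Sum>S\<in>{S \<in> ?I. fst ` S = T}. g (fst ` S)) = (\<Sum>S\<in>{S \<in> ?I. fst ` S = T}. g T)"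
      by (rule sum.cong) auto
    also have "\<dots> = g T * of_nat (card {S \<in> ?I. fst ` S = T})"
      by simp
    also have "card {S \<in> ?I. fst ` S = T} = (\<Prod>v\<in>T. card (B v))"
      using card_transversals[OF T, of B] by (simp add: conj_assoc)
    finally show "(\<Sum>S\<in>{S \<in> ?I. fst ` S = T}. g (fst ` S)) = g T * of_nat (\<Prod>v\<in>T. card (B v))" .
  qed simp
  finally show ?thesis by (simp add: g_def)
qed


section \<open>Distances in a blowup\<close>

lemma (in pair_wf_digraph) awalk_length_iff_relpow:
  assumes "u \<in> pverts G"
  shows "(\<exists>p. awalk u p v \<and> length p = k) \<longleftrightarrow> (u, v) \<in> parcs G ^^ k"
  using assms
proof (induction k arbitrary: u)
  case 0
  then show ?case by (auto simp: awalk_Nil_iff)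
next
  case (Suc k)
  have "(\<exists>p. awalk u p v \<and> length p = Suc k) \<longleftrightarrow>
        (\<exists>w. (u, w) \<in> parcs G \<and> (\<exists>p. awalk w p v \<and> length p = k))"
  proof
    assume "\<exists>p. awalk u p v \<and> length p = Suc k"
    then show "\<exists>w. (u, w) \<in> parcs G \<and> (\<exists>p. awalk w p v \<and> length p = k)"
      by (fastforce simp: length_Suc_conv awalk_Cons_iff)
  next
    assume "\<exists>w. (u, w) \<in> parcs G \<and> (\<exists>p. awalk w p v \<and> length p = k)"
    then obtain w p where "(u, w) \<in> parcs G" "awalk w p v" "length p = k" by blast
    then have "awalk u ((u, w) # p) v \<and> length ((u, w) # p) = Suc k"
      by (simp add: awalk_Cons_iff)
    then show "\<exists>p. awalk u p v \<and> length p = Suc k" by blast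
  qed
  also have "\<dots> \<longleftrightarrow> (\<exists>w. (u, w) \<in> parcs G \<and> (w, v) \<in> parcs G ^^ k)"
    using Suc.IH in_arcsD2 by blast
  also have "\<dots> \<longleftrightarrow> (u, v) \<in> parcs G ^^ Suc k"
    by (metis relpow_Suc_D2 relpow_Suc_I2)
  finally show ?case .
qed

text \<open>A shortest walk is a path, since cutting out a cycle would shorten it. Walks are easier to
  map between a graph and its blowup than paths: their images need not be checked for repeated
  vertices.\<close>

lemma (in pair_wf_digraph) path_dist_eq_relpow:
  assumes "u \<in> pverts G"
  shows "path_dist G u v = (LEAST k. (u, v) \<in> parcs G ^^ k)"
proof (cases "\<exists>k. (u, v) \<in> parcs G ^^ k")
  case False
  then have "(\<lambda>k. \<exists>p. apath u p v \<and> length p = k) = (\<lambda>k. (u, v) \<in> parcs G ^^ k)"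
    using awalk_length_iff_relpow[OF assms] by (auto simp: apath_def fun_eq_iff)
  then show ?thesis by (simp add: path_dist_def)
next
  case True
  define K where "K = (LEAST k. (u, v) \<in> parcs G ^^ k)"
  have K: "(u, v) \<in> parcs G ^^ K"
    unfolding K_def using True by (rule LeastI_ex)
  have min: "K \<le> length p" if "awalk u p v" for p
    unfolding K_def using that awalk_length_iff_relpow[OF assms] by (intro Least_le) blast
  obtain p where p: "awalk u p v" "length p = K"
    using K awalk_length_iff_relpow[OF assms] by blast
  have "apath u p v"
  proof (rule ccontr)
    assume "\<not> apath u p v"
    then have "\<not> distinct (awalk_verts u p)" using p by (simp add: apath_def)
    then obtain q r s w where dec: "p = q @ r @ s" "0 < length r" "awalk u q w" "awalk w s v"
      using awalk_not_distinct_decomp[OF p(1)] by blast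
    have "K \<le> length (q @ s)" by (rule min) (use dec in \<open>auto intro: awalk_appendI\<close>)
    then show False using dec(1,2) p(2) by (simp del: length_greater_0_conv)
  qed
  with p(2) min have "(LEAST k. \<exists>p. apath u p v \<and> length p = k) = K"
    by (intro Least_equality) (auto simp: apath_def)
  then show ?thesis by (simp add: path_dist_def K_def)
qed

text \<open>Walks of the blowup project to \<open>G\<close>. Conversely a walk in \<open>G\<close> lifts by passing through the
  copies numbered \<open>0\<close> of its inner vertices, while both of its end points may be lifted freely.
  This freedom is what excludes \<open>k = 0\<close>: a walk without arcs has a single end point.\<close>

lemma relpow_blowup_iff:
  assumes G: "pair_graph G" and n: "\<forall>v\<in>pverts G. n v > 0" and k: "k > 0"
    and "(v, i) \<in> pverts (blowup G n)" "(w, j) \<in> pverts (blowup G n)"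
  shows "((v, i), (w, j)) \<in> parcs (blowup G n) ^^ k \<longleftrightarrow> (v, w) \<in> parcs G ^^ k"
proof
  interpret pair_graph G by fact
  have down: "(fst x, fst y) \<in> parcs G ^^ k" if "(x, y) \<in> parcs (blowup G n) ^^ k" for x y k
    using that
  proof (induction k arbitrary: y)
    case (Suc k)
    then show ?case by (fastforce simp: blowup_def)
  qed simp
  show "(v, w) \<in> parcs G ^^ k" if "((v, i), (w, j)) \<in> parcs (blowup G n) ^^ k"
    using down[OF that] by simp
  have arc: "((a, l), (b, m)) \<in> parcs (blowup G n)"
    if "(a, b) \<in> parcs G" "l < n a" "m < n b" for a b l m
    using that pair_no_loops[OF that(1)] in_arcsD1[OF that(1)] in_arcsD2[OF that(1)]
    by (auto simp: blowup_def)
  show "((v, i), (w, j)) \<in> parcs (blowup G n) ^^ k" if "(v, w) \<in> parcs G ^^ k"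
    using k that assms(4,5)
  proof (induction k arbitrary: w j rule: nat_induct_non_zero)
    case 1
    then show ?case using arc by (auto simp: blowup_def)
  next
    case (Suc k)
    obtain u where u: "(v, u) \<in> parcs G ^^ k" "(u, w) \<in> parcs G"
      using Suc.prems(1) by auto
    have uV: "u \<in> pverts G" using in_arcsD1[OF u(2)] .
    then have "((v, i), (u, 0)) \<in> parcs (blowup G n) ^^ k"
      using n u(1) Suc.prems(2) by (intro Suc.IH) (auto simp: blowup_def)
    moreover have "((u, 0), (w, j)) \<in> parcs (blowup G n)"
      using arc[OF u(2)] n uV Suc.prems(3) by (auto simp: blowup_def)
    ultimately show ?case by (rule relpow_Suc_I)
  qed
qed

lemma path_dist_blowup_distinct:
  assumes G: "pair_graph G" and n: "\<forall>v\<in>pverts G. n v > 0"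
    and x: "(v, i) \<in> pverts (blowup G n)" and y: "(w, j) \<in> pverts (blowup G n)"
    and "v \<noteq> w"
  shows "path_dist (blowup G n) (v, i) (w, j) = path_dist G v w"
proof -
  interpret G: pair_graph G by fact
  interpret B: pair_graph "blowup G n" by (rule pair_graph_blowup[OF G])
  have v: "v \<in> pverts G" using x by (simp add: blowup_def)
  have "((v, i), (w, j)) \<in> parcs (blowup G n) ^^ k \<longleftrightarrow> (v, w) \<in> parcs G ^^ k" for k
    using relpow_blowup_iff[OF G n _ x y] \<open>v \<noteq> w\<close> by (cases "k = 0") auto
  then show ?thesis
    by (simp add: B.path_dist_eq_relpow[OF x] G.path_dist_eq_relpow[OF v])
qed

lemma path_dist_blowup_copies:
  assumes G: "pair_graph G" and n: "\<forall>v\<in>pverts G. n v > 0"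
    and x: "(v, i) \<in> pverts (blowup G n)" and y: "(v, j) \<in> pverts (blowup G n)"
    and "i \<noteq> j" and u: "(v, u) \<in> parcs G"
  shows "path_dist (blowup G n) (v, i) (v, j) = 2"
proof -
  interpret G: pair_graph G by fact
  interpret B: pair_graph "blowup G n" by (rule pair_graph_blowup[OF G])
  have "(u, v) \<in> parcs G"
    using u G.pair_sym_arcs by (auto simp: symmetric_def sym_def)
  then have "(v, v) \<in> parcs G ^^ 2"
    using u by (auto simp: numeral_2_eq_2)
  then have 2: "((v, i), (v, j)) \<in> parcs (blowup G n) ^^ 2"
    using relpow_blowup_iff[OF G n _ x y] by simp
  have "k \<ge> 2" if k: "((v, i), (v, j)) \<in> parcs (blowup G n) ^^ k" for k
  proof (rule ccontr)
    assume "\<not> k \<ge> 2"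
    then consider "k = 0" | "k = 1" by linarith
    then show False
      using k \<open>i \<noteq> j\<close> by cases (auto simp: blowup_def)
  qed
  with 2 show ?thesis
    unfolding B.path_dist_eq_relpow[OF x] by (intro Least_equality)
qed

lemma connected_ex_arc:
  assumes "pair_graph G" "Digraph_Component.connected (with_proj G)" "card (pverts G) \<ge> 2"
    and v: "v \<in> pverts G"
  shows "\<exists>u. (v, u) \<in> parcs G"
proof -
  interpret pair_graph G by fact
  have "pverts G \<noteq> {v}" using assms(3) by auto
  then obtain w where "w \<in> pverts G" "w \<noteq> v" using v by blast
  then have "v \<rightarrow>\<^sup>*\<^bsub>with_proj G\<^esub> w"
    using assms(2) v unfolding connected_pair_graph_iff[OF assms(1)] strongly_connected_def
    by simp
  then show ?thesis
    using \<open>w \<noteq> v\<close> by (cases rule: converse_reachable_cases) auto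
qed


section \<open>Multi-affine polynomials\<close>

definition squarefree_monom :: "'v set \<Rightarrow> 'v \<Rightarrow>\<^sub>0 nat" where
  "squarefree_monom T = (\<Sum>v\<in>T. Poly_Mapping.single v 1)"

definition multiaffine :: "'v set \<Rightarrow> ('v set \<Rightarrow> int) \<Rightarrow> 'v mpoly_int" where
  "multiaffine V c = (\<Sum>T\<in>Pow V. Poly_Mapping.single (squarefree_monom T) (c T))"

lemma lookup_squarefree_monom:
  "finite T \<Longrightarrow> Poly_Mapping.lookup (squarefree_monom T) v = (if v \<in> T then 1 else 0)"
  by (simp add: squarefree_monom_def lookup_sum lookup_single when_def)

lemma keys_squarefree_monom: "finite T \<Longrightarrow> Poly_Mapping.keys (squarefree_monom T) = T"
  by (auto simp: in_keys_iff lookup_squarefree_monom split: if_splits)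

lemma inj_on_squarefree_monom: "finite V \<Longrightarrow> inj_on squarefree_monom (Pow V)"
  by (rule inj_on_inverseI[where g = Poly_Mapping.keys])
     (simp add: keys_squarefree_monom finite_subset)

lemma lookup_multiaffine:
  assumes "finite V" "T \<subseteq> V"
  shows "Poly_Mapping.lookup (multiaffine V c) (squarefree_monom T) = c T"
proof -
  have "Poly_Mapping.lookup (multiaffine V c) (squarefree_monom T) =
          (\<Sum>S\<in>Pow V. if S = T then c S else 0)"
    unfolding multiaffine_def lookup_sum
    by (rule sum.cong) (use assms inj_on_squarefree_monom[OF assms(1)] in
        \<open>auto simp: lookup_single when_def inj_on_def\<close>)
  also have "\<dots> = c T" using assms by simp
  finally show ?thesis .
qed

lemma keys_multiaffine:
  assumes "finite V"
  shows "Poly_Mapping.keys (multiaffine V c) \<subseteq> squarefree_monom ` Pow V"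
proof
  fix m assume "m \<in> Poly_Mapping.keys (multiaffine V c)"
  then have "(\<Sum>S\<in>Pow V. c S when squarefree_monom S = m) \<noteq> 0"
    by (simp add: in_keys_iff multiaffine_def lookup_sum lookup_single)
  then obtain S where "S \<in> Pow V" "(c S when squarefree_monom S = m) \<noteq> 0"
    by (rule sum.not_neutral_contains_not_neutral)
  then show "m \<in> squarefree_monom ` Pow V" by auto
qed

lemma mvars_multiaffine:
  assumes "finite V"
  shows "mvars (multiaffine V c) \<subseteq> V"
proof
  fix v assume "v \<in> mvars (multiaffine V c)"
  then obtain T where "T \<subseteq> V" "v \<in> Poly_Mapping.keys (squarefree_monom T)"
    using keys_multiaffine[OF assms, of c] by (auto simp: mvars_def)
  then show "v \<in> V"
    using assms by (auto simp: keys_squarefree_monom finite_subset)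
qed

lemma mdegree_in_multiaffine:
  assumes "finite V"
  shows "mdegree_in v (multiaffine V c) \<le> 1"
proof -
  have "Poly_Mapping.lookup m v \<le> 1" if "m \<in> Poly_Mapping.keys (multiaffine V c)" for m
    using that keys_multiaffine[OF assms, of c] assms
    by (auto simp: lookup_squarefree_monom finite_subset)
  then show ?thesis
    unfolding mdegree_in_def by (subst Max_le_iff) auto
qed

lemma constant_term_multiaffine: "finite V \<Longrightarrow> constant_term (multiaffine V c) = c {}"
  using lookup_multiaffine[of V "{}" c] by (simp add: constant_term_def squarefree_monom_def)

lemma meval_multiaffine:
  assumes "finite V"
  shows "meval (multiaffine V c) x = (\<Sum>T\<in>Pow V. c T * (\<Prod>v\<in>T. x v))"
proof -
  let ?p = "multiaffine V c"
  let ?t = "\<lambda>m. Poly_Mapping.lookup ?p m *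
                 (\<Prod>v\<in>Poly_Mapping.keys m. x v ^ Poly_Mapping.lookup m v)"
  have "meval ?p x = (\<Sum>m\<in>squarefree_monom ` Pow V. ?t m)"
    unfolding meval_def using keys_multiaffine[OF assms, of c] assms
    by (intro sum.mono_neutral_left) (auto simp: in_keys_iff)
  also have "\<dots> = (\<Sum>T\<in>Pow V. ?t (squarefree_monom T))"
    using inj_on_squarefree_monom[OF assms] by (simp add: sum.reindex)
  also have "\<dots> = (\<Sum>T\<in>Pow V. c T * (\<Prod>v\<in>T. x v))"
  proof (rule sum.cong)
    fix T assume "T \<in> Pow V"
    then have T: "T \<subseteq> V" "finite T" using assms finite_subset by auto
    show "?t (squarefree_monom T) = c T * (\<Prod>v\<in>T. x v)"
      using T by (simp add: lookup_multiaffine[OF assms] keys_squarefree_monom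
          lookup_squarefree_monom)
  qed simp
  finally show ?thesis .
qed

lemma monom_degree_squarefree: "finite T \<Longrightarrow> monom_degree (squarefree_monom T) = card T"
  by (simp add: monom_degree_def keys_squarefree_monom lookup_squarefree_monom)

lemma homogeneous_part_multiaffine:
  assumes V: "finite V"
  shows "homogeneous_part d (multiaffine V c) =
           (\<Sum>T\<in>{T \<in> Pow V. card T = d}. Poly_Mapping.single (squarefree_monom T) (c T))"
proof -
  let ?p = "multiaffine V c"
  let ?M = "{m \<in> squarefree_monom ` Pow V. monom_degree m = d}"
  have M: "?M = squarefree_monom ` {T \<in> Pow V. card T = d}"
    using V by (auto simp: monom_degree_squarefree finite_subset)
  have "homogeneous_part d ?p = (\<Sum>m\<in>?M. Poly_Mapping.single m (Poly_Mapping.lookup ?p m))"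
    unfolding homogeneous_part_def using keys_multiaffine[OF V, of c] V
    by (intro sum.mono_neutral_left) (auto simp: in_keys_iff)
  also have "\<dots> = (\<Sum>T\<in>{T \<in> Pow V. card T = d}.
                 Poly_Mapping.single (squarefree_monom T)
                   (Poly_Mapping.lookup ?p (squarefree_monom T)))"
    unfolding M
    by (subst sum.reindex) (auto intro: inj_on_subset[OF inj_on_squarefree_monom[OF V]])
  also have "\<dots> = (\<Sum>T\<in>{T \<in> Pow V. card T = d}.
                 Poly_Mapping.single (squarefree_monom T) (c T))"
    by (rule sum.cong) (auto simp: lookup_multiaffine[OF V])
  finally show ?thesis .
qed

lemma power_single_zero:
  "Poly_Mapping.single 0 a ^ k = Poly_Mapping.single (0 :: 'v \<Rightarrow>\<^sub>0 nat) (a ^ k :: int)"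
  by (induction k) (simp_all add: mult_single)

text \<open>The power is written over a constant polynomial because the scalar factor of the linear part
  appears in the theorem as a power in the polynomial ring, not as a power of an integer.\<close>

lemma linear_part_multiaffine:
  assumes V: "finite V" and c: "\<And>v. v \<in> V \<Longrightarrow> c {v} = - (a ^ k)"
  shows "homogeneous_part 1 (multiaffine V c) =
           - (Poly_Mapping.single 0 a ^ k * (\<Sum>v\<in>V. mvar v))"
proof -
  have sing: "{T \<in> Pow V. card T = 1} = (\<lambda>v. {v}) ` V"
    by (auto simp: card_1_singleton_iff)
  have "homogeneous_part 1 (multiaffine V c) =
          (\<Sum>v\<in>V. Poly_Mapping.single (squarefree_monom {v}) (c {v}))"
    unfolding homogeneous_part_multiaffine[OF V] sing by (subst sum.reindex) auto
  also have "\<dots> = (\<Sum>v\<in>V. - (Poly_Mapping.single 0 a ^ k * mvar v))"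
    by (rule sum.cong)
       (simp_all add: c squarefree_monom_def mvar_def power_single_zero mult_single single_uminus)
  finally show ?thesis by (simp add: sum_distrib_left sum_negf)
qed


section \<open>The determinant of the distance matrix of a blowup\<close>

text \<open>The diagonal value \<open>2\<close> is the distance between distinct copies of a vertex.\<close>

definition padded_dist :: "'v pair_pre_digraph \<Rightarrow> 'v \<Rightarrow> 'v \<Rightarrow> int" where
  "padded_dist G v w = (if v = w then 2 else int (path_dist G v w))"

text \<open>These are the coefficients of the determinant of \<open>M N - 2 I\<close> as a polynomial in the entries of
  the diagonal matrix \<open>N\<close>, where \<open>M\<close> is the matrix \<open>padded_dist G\<close>.\<close>

definition blowup_coeff :: "'v pair_pre_digraph \<Rightarrow> 'v set \<Rightarrow> int" where
  "blowup_coeff G T = (-2) ^ (card (pverts G) - card T) * det_on T (padded_dist G)"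

lemma det_distance_matrix_blowup:
  assumes G: "pair_graph G" "Digraph_Component.connected (with_proj G)" "card (pverts G) \<ge> 2"
    and n: "\<forall>v\<in>pverts G. n v > 0" and xs: "is_enumeration xs (pverts (blowup G n))"
  shows "Determinant.det (distance_matrix (blowup G n) xs) =
    (-2) ^ (\<Sum>v\<in>pverts G. n v - 1) *
      (\<Sum>T\<in>Pow (pverts G). blowup_coeff G T * (\<Prod>v\<in>T. int (n v)))"
proof -
  interpret pair_graph G by (rule G(1))
  let ?V = "pverts G" and ?B = "blowup G n" and ?M = "padded_dist G"
  let ?X = "SIGMA v:?V. {..<n v}" and ?e = "\<Sum>v\<in>?V. n v - 1"
  let ?D = "\<lambda>x y. if x = y then 0 else int (path_dist ?B x y)"
  have X: "pverts ?B = ?X" by (auto simp: blowup_def)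
  have V: "finite ?V" by (rule pair_finite_verts)
  \<comment> \<open>As each \<open>n v\<close> is positive, the truncated differences in the exponent are true differences.\<close>
  have "(\<Sum>v\<in>?V. n v) = (\<Sum>v\<in>?V. (n v - 1) + 1)"
    using n by (intro sum.cong) auto
  then have cardX: "card ?X = ?e + card ?V"
    using V by (simp only: sum.distrib) simp
  have "Determinant.det (distance_matrix ?B xs) = det_on ?X ?D"
    using xs det_mat_eq_det_on[of xs ?D] by (simp add: distance_matrix_def is_enumeration_def X)
  also have "\<dots> = det_on ?X (\<lambda>x y. ?M (fst x) (fst y) + (if x = y then -2 else 0))"
  proof (rule det_on_cong)
    fix x y assume x: "x \<in> ?X" and y: "y \<in> ?X"
    obtain v i w j where xy: "x = (v, i)" "y = (w, j)" by (cases x, cases y)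
    note xB = x[folded X, unfolded xy] and yB = y[folded X, unfolded xy]
    show "?D x y = ?M (fst x) (fst y) + (if x = y then -2 else 0)"
    proof (cases "v = w")
      case True
      obtain u where "(v, u) \<in> parcs G" using connected_ex_arc[OF G] x xy by auto
      then show ?thesis
        using path_dist_blowup_copies[OF G(1) n xB] yB True by (auto simp: xy padded_dist_def)
    next
      case False
      then show ?thesis
        using path_dist_blowup_distinct[OF G(1) n xB yB] by (simp add: xy padded_dist_def)
    qed
  qed
  also have "\<dots> = (\<Sum>T\<in>Pow ?V. (-2) ^ (card ?X - card T) * det_on T ?M *
                        of_nat (\<Prod>v\<in>T. card {..<n v}))"
    by (rule det_on_replicated) (use V in auto)
  also have "\<dots> = (\<Sum>T\<in>Pow ?V. (-2) ^ ?e * (blowup_coeff G T * (\<Prod>v\<in>T. int (n v))))"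
  proof (rule sum.cong)
    fix T assume "T \<in> Pow ?V"
    then have "card T \<le> card ?V" using V by (simp add: card_mono)
    \<comment> \<open>The surplus of copies over vertices does not depend on \<open>T\<close>, so its power of \<open>-2\<close> factors out.\<close>
    then have "card ?X - card T = ?e + (card ?V - card T)" using cardX by simp
    then show "(-2) ^ (card ?X - card T) * det_on T ?M * of_nat (\<Prod>v\<in>T. card {..<n v}) =
        (-2) ^ ?e * (blowup_coeff G T * (\<Prod>v\<in>T. int (n v)))"
      by (simp only: blowup_coeff_def power_add) simp
  qed simp
  finally show ?thesis by (simp add: sum_distrib_left)
qed

theorem theorem1p2:
  fixes G :: "'v pair_pre_digraph"
  assumes "pair_graph G"
    and "Digraph_Component.connected (with_proj G)"
    and "card (pverts G) \<ge> 2"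
  shows "\<exists>p :: 'v mpoly_int.
    mvars p \<subseteq> pverts G \<and>
    (\<forall>n :: 'v \<Rightarrow> nat. (\<forall>v\<in>pverts G. n v > 0) \<longrightarrow>
      (\<forall>xs. is_enumeration xs (pverts (blowup G n)) \<longrightarrow>
        Determinant.det (distance_matrix (blowup G n) xs) =
          (-2) ^ (\<Sum>v\<in>pverts G. n v - 1) * meval p (\<lambda>v. int (n v)))) \<and>
    (\<forall>v\<in>pverts G. mdegree_in v p \<le> 1) \<and>
    constant_term p = (-2) ^ card (pverts G) \<and>
    homogeneous_part 1 p = - ((-2) ^ card (pverts G) * (\<Sum>v\<in>pverts G. mvar v))"
proof -
  interpret pair_graph G by (rule assms(1))
  let ?p = "multiaffine (pverts G) (blowup_coeff G)"
  note V = pair_finite_verts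
  have two: "Poly_Mapping.single 0 (-2) = (-2 :: 'v mpoly_int)"
    by (simp add: single_uminus)
  have "blowup_coeff G {v} = - ((-2) ^ card (pverts G))" for v
    using assms(3) by (cases "card (pverts G)") (auto simp: blowup_coeff_def padded_dist_def)
  then have "homogeneous_part 1 ?p = - ((-2) ^ card (pverts G) * (\<Sum>v\<in>pverts G. mvar v))"
    using linear_part_multiaffine[OF V, of "blowup_coeff G" "-2"] by (simp only: two)
  moreover have "constant_term ?p = (-2) ^ card (pverts G)"
    by (simp add: constant_term_multiaffine[OF V] blowup_coeff_def)
  ultimately show ?thesis
    using mvars_multiaffine[OF V] mdegree_in_multiaffine[OF V]
      det_distance_matrix_blowup[OF assms] meval_multiaffine[OF V]
    by (intro exI[of _ ?p]) simp
qed

end
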